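(* Consider an MDP-JLS with ergodic unichain MDP $\mathcal{M}=(S,\hat{s},\Sigma,T)$ and mode matrices $A_s\in\mathbb{R}^{n\times n}$, $s\in S$. Let $0<\alpha<1$ and $\mu>1$ be stability constants, i.e. there is a Lyapunov function candidate $\{V_s : s\in S\}$ with $V_s(A_sx)-V_s(x)\le-\alpha V_s(x)$ and $V_s(x)\le\mu V_{s'}(x)$ for all $s,s'\in S$, $x\in\mathbb{R}^n$. Let $\epsilon>0$ be small and $c:S\to\mathbb{R}$ a cost function. Consider the linear optimization problem in the variables $\hat\pi\in\mathbb{R}^{|S|\times|\Sigma|}$, $p^\infty\in\mathbb{R}^{|S|}$, $\hat P\in\mathbb{R}^{|S|\times|S|}$: $$\begin{aligned}\text{minimize}\quad&\sum_{s}c(s)p_s^\infty\\ \text{subject to}\quad&\hat\pi\mathbf 1=p^\infty,\quad \mathbf 1'p^\infty=1,\quad \hat P'\mathbf 1=p^\infty,\\ &\hat P_{ij}=\sum_{\sigma}T(i,\sigma,j)\hat\pi(i,\sigma)\quad\forall i,j\in S,\\ &1-\mathrm{Tr}(\hat P)<\frac{\ln\left(\frac1{1-\alpha}\right)}{\ln(\mu)},\\ &\hat\pi\ge0,\quad p^\infty\ge\epsilon,\end{aligned}$$ where the last two inequalities are entrywise. If $(\hat\pi_{opt},p^\infty_{opt},\hat P_{opt})$ is an optimal solution, then $$\pi=\mathrm{diag}(p^\infty_{opt})^{-1}\hat\pi_{opt},\qquad P=\mathrm{diag}(p^\infty_{opt})^{-1}\hat P_{opt},\qquad p^\infty=p^\infty_{opt}$$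 are respectively a policy of $\mathcal{M}$, the transition matrix of the DTMC induced by $\pi$, and the stationary distribution of that DTMC, and the MJLS induced by $\pi$ is stable with probability one.
   Context: An MDP is a tuple $\mathcal{M}=(S,\hat{s},\Sigma,T)$ with finite state set $S$, initial state $\hat s\in S$, finite action set $\Sigma$, and transition function $T(s,\sigma,s')=p(s'|s,\sigma)$ (states are indexed, $T(i,\sigma,j)=T(s_i,\sigma,s_j)$). If $\sigma$ is available at $s$ then $T(s,\sigma,\cdot)$ is a probability distribution; otherwise $T(s,\sigma,\cdot)=0$ and policies do not select $\sigma$ at $s$. A policy $\pi:S\times\Sigma\to[0,1]$ gives the probability $\pi(s,\sigma)$ of taking action $\sigma$ at $s$. Under $\pi$ the MDP reduces to a discrete-time Markov chain (DTMC) $(S,\hat s,P)$ with $P_{ij}=\sum_{\sigma}T(i,\sigma,j)\pi(i,\sigma)$. A DTMC is an ergodic unichain if it has a single ergodic class (communicating class of recurrent aperiodic states) and possibly some transient states; an MDP is an ergodic unichain if every policy induces an ergodic unichain DTMC (so the stationary distribution exists and is unique). An MDP-JLS is the switched system $x(k+1)=A_{s_k}x(k)$, $x(k)\in\mathbb{R}^n$, where $s_k\in S$ is the mode at time $k$, with the mode process governed by $\mathcal{M}$. Given a policy it becomes a Markov jump linear system (MJLS): the modes follow the induced DTMC. An MJLS is stable with probability one if, for any initial condition $x_0$, $\lim_{k\to\infty}\|x(k)\|_\infty=0$ with probability one. Lyapunov function candidate: each $V_s:\mathbb{R}^n\to\mathbb{R}$ is continuous, radially unbounded, $V_s(0)=0$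 and $V_s(x)>0$ for $x\ne0$. $\mathbf 1$ is the all-ones column vector of suitable dimension, $'$ is transpose, and $\mathrm{diag}(v)$ is the diagonal matrix with diagonal $v$. *)

theory Defs
  imports "HOL-Probability.Probability"
begin

section \<open>Markov decision processes\<close>

text \<open>
  The finite state and action sets are the types \<open>'s\<close> and \<open>'a\<close>. State- and
  state-action-indexed data that enter the optimization problem are vectors
  \<open>real ^ 's\<close> and matrices \<open>real ^ 'a ^ 's\<close> (rows indexed by states).
\<close>

record ('s, 'a) mdp =
  init_state :: 's
  transition :: "'s \<Rightarrow> 'a \<Rightarrow> 's \<Rightarrow> real"

text \<open>Availability is encoded in the transition function: unavailable means identically zero.\<close>

definition available :: "('s, 'a) mdp \<Rightarrow> 's \<Rightarrow> 'a \<Rightarrow> bool" where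
  "available M s a \<longleftrightarrow> (\<exists>s'. transition M s a s' \<noteq> 0)"

definition is_mdp :: "('s::finite, 'a::finite) mdp \<Rightarrow> bool" where
  "is_mdp M \<longleftrightarrow>
     (\<forall>s a. available M s a \<longrightarrow>
        (\<forall>s'. 0 \<le> transition M s a s') \<and> (\<Sum>s'\<in>UNIV. transition M s a s') = 1)"

definition is_policy :: "('s::finite, 'a::finite) mdp \<Rightarrow> real ^ 'a ^ 's \<Rightarrow> bool" where
  "is_policy M \<pi> \<longleftrightarrow>
     (\<forall>s a. 0 \<le> \<pi> $ s $ a \<and> \<pi> $ s $ a \<le> 1) \<and>
     (\<forall>s. (\<Sum>a\<in>UNIV. \<pi> $ s $ a) = 1) \<and>
     (\<forall>s a. \<not> available M s a \<longrightarrow> \<pi> $ s $ a = 0)"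

definition induced_matrix :: "('s::finite, 'a::finite) mdp \<Rightarrow> real ^ 'a ^ 's \<Rightarrow> real ^ 's ^ 's" where
  "induced_matrix M \<pi> = (\<chi> i j. \<Sum>a\<in>UNIV. transition M i a j * \<pi> $ i $ a)"

section \<open>Finite discrete-time Markov chains\<close>

text \<open>Powers for the matrix product; the class operation \<open>^\<close> on \<open>real ^ 's ^ 's\<close> is entrywise.\<close>

definition matrix_pow :: "real ^ 's ^ 's \<Rightarrow> nat \<Rightarrow> real ^ 's::finite ^ 's" where
  "matrix_pow P n = (((**) P) ^^ n) (mat 1)"

definition accessible :: "real ^ 's ^ 's \<Rightarrow> 's::finite \<Rightarrow> 's \<Rightarrow> bool" where
  "accessible P i j \<longleftrightarrow> (\<exists>n. 0 < matrix_pow P n $ i $ j)"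

definition communicate :: "real ^ 's ^ 's \<Rightarrow> 's::finite \<Rightarrow> 's \<Rightarrow> bool" where
  "communicate P i j \<longleftrightarrow> accessible P i j \<and> accessible P j i"

text \<open>
  \<open>first_passage P n i j\<close> is the probability that the chain started in \<open>i\<close> visits \<open>j\<close> at time
  \<open>n + 1\<close> and at none of the times \<open>1, \<dots>, n\<close>.
\<close>

primrec first_passage :: "real ^ 's ^ 's \<Rightarrow> nat \<Rightarrow> 's::finite \<Rightarrow> 's \<Rightarrow> real" where
  "first_passage P 0 i j = P $ i $ j"
| "first_passage P (Suc n) i j = (\<Sum>k\<in>UNIV - {j}. P $ i $ k * first_passage P n k j)"

definition recurrent :: "real ^ 's ^ 's \<Rightarrow> 's::finite \<Rightarrow> bool" where
  "recurrent P i \<longleftrightarrow> (\<lambda>n. first_passage P n i i) sums 1"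

definition transient :: "real ^ 's ^ 's \<Rightarrow> 's::finite \<Rightarrow> bool" where
  "transient P i \<longleftrightarrow> \<not> recurrent P i"

definition aperiodic :: "real ^ 's ^ 's \<Rightarrow> 's::finite \<Rightarrow> bool" where
  "aperiodic P i \<longleftrightarrow> Gcd {n. 0 < n \<and> 0 < matrix_pow P n $ i $ i} = 1"

definition ergodic_class :: "real ^ 's ^ 's \<Rightarrow> 's::finite set \<Rightarrow> bool" where
  "ergodic_class P C \<longleftrightarrow>
     (\<exists>i. C = {j. communicate P i j}) \<and> (\<forall>i\<in>C. recurrent P i \<and> aperiodic P i)"

text \<open>
  Since all states outside \<open>C\<close> are transient, \<open>C\<close> is the only ergodic class (and the only
  recurrent class).
\<close>

definition ergodic_unichain :: "real ^ 's ^ 's::finite \<Rightarrow> bool" where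
  "ergodic_unichain P \<longleftrightarrow> (\<exists>C. ergodic_class P C \<and> (\<forall>i. i \<notin> C \<longrightarrow> transient P i))"

definition mdp_ergodic_unichain :: "('s::finite, 'a::finite) mdp \<Rightarrow> bool" where
  "mdp_ergodic_unichain M \<longleftrightarrow> (\<forall>\<pi>. is_policy M \<pi> \<longrightarrow> ergodic_unichain (induced_matrix M \<pi>))"

definition stationary_distribution :: "real ^ 's ^ 's \<Rightarrow> real ^ 's::finite \<Rightarrow> bool" where
  "stationary_distribution P p \<longleftrightarrow> (\<forall>s. 0 \<le> p $ s) \<and> (\<Sum>s\<in>UNIV. p $ s) = 1 \<and> p v* P = p"

text \<open>
  \<open>X\<close> is a realization, on the probability space \<open>W\<close>, of the DTMC with initial state \<open>s0\<close> and
  transition matrix \<open>P\<close>. The last conjunct is the Markov property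
  \<open>Pr(X (k+1) = i (k+1) | X 0 = i 0, \<dots>, X k = i k) = P (i k) (i (k+1))\<close>, multiplied out by the
  probability of the conditioning event.
\<close>

definition dtmc_process ::
  "'w measure \<Rightarrow> (nat \<Rightarrow> 'w \<Rightarrow> 's) \<Rightarrow> 's \<Rightarrow> real ^ 's ^ 's::finite \<Rightarrow> bool" where
  "dtmc_process W X s0 P \<longleftrightarrow>
     prob_space W \<and>
     (\<forall>k. X k \<in> measurable W (count_space UNIV)) \<and>
     (AE w in W. X 0 w = s0) \<and>
     (\<forall>k i. measure W {w \<in> space W. \<forall>j\<le>Suc k. X j w = i j} =
        measure W {w \<in> space W. \<forall>j\<le>k. X j w = i j} * P $ i k $ i (Suc k))"

text \<open>
  Every stochastic matrix has such a realization, so quantifying over realizations is not vacuous.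
  It is built from an i.i.d. sequence of random self-maps of the state space.
\<close>

primrec walk :: "'s \<Rightarrow> ('s \<Rightarrow> 's) stream \<Rightarrow> nat \<Rightarrow> 's" where
  "walk s w 0 = s"
| "walk s w (Suc k) = walk (shd w s) (stl w) k"

lemma walk_measurable [measurable]:
  fixes D :: "('s::finite \<Rightarrow> 's) pmf"
  shows "(\<lambda>w. walk s w k) \<in> measurable (stream_space (measure_pmf D)) (count_space UNIV)"
proof (induction k arbitrary: s)
  case (Suc k)
  have [measurable]: "(\<lambda>w. walk s' w k) \<in> measurable (stream_space (measure_pmf D)) (count_space UNIV)" for s'
    by (rule Suc)
  have 1: "(\<lambda>w. walk s' (stl w) k) \<in> measurable (stream_space (measure_pmf D)) (count_space UNIV)" for s'
    by measurable
  have 2: "shd \<in> measurable (stream_space (measure_pmf D)) (count_space UNIV)"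
    by measurable
  have 3: "(\<lambda>w. shd w s) \<in> measurable (stream_space (measure_pmf D)) (count_space UNIV)"
    using measurable_compose[OF 2, of "\<lambda>f. f s"] by simp
  show ?case
    using measurable_compose_countable[OF 1 3] by simp
qed simp

lemma dtmc_process_exists:
  fixes P :: "real ^ 's ^ 's::finite"
  assumes nn: "\<And>i j. 0 \<le> P $ i $ j" and st: "\<And>i. (\<Sum>j\<in>UNIV. P $ i $ j) = 1"
  shows "\<exists>(W :: ('s \<Rightarrow> 's) stream measure) X. dtmc_process W X s0 P"
proof -
  define r where "r i = embed_pmf (\<lambda>j. P $ i $ j)" for i
  have r: "pmf (r i) j = P $ i $ j" for i j
    unfolding r_def
    by (rule pmf_embed_pmf) (auto simp: nn st nn_integral_count_space_finite sum_nonneg ennreal_1[symmetric] simp del: ennreal_1)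
  define D where "D = Pi_pmf UNIV undefined r"
  have Dc: "map_pmf (\<lambda>f. f i) D = r i" for i
    unfolding D_def by (subst Pi_pmf_component) auto
  let ?S = "stream_space (measure_pmf D)"
  interpret S: prob_space ?S by (rule prob_space.prob_space_stream_space[OF prob_space_measure_pmf])
  have spS: "space ?S = UNIV" by (simp add: space_stream_space)
  have cyl: "emeasure ?S {w\<in>space ?S. \<forall>j\<le>k. walk s w j = i j} =
      (if s = i 0 then ennreal (\<Prod>j<k. P $ i j $ i (Suc j)) else 0)" for k s i
  proof (induction k arbitrary: s i)
    case 0
    show ?case using S.emeasure_space_1 by (auto simp: spS)
  next
    case (Suc k)
    have m: "{w\<in>space ?S. \<forall>j\<le>Suc k. walk s w j = i j} \<in> sets ?S" by measurable
    have sp: "(\<forall>j\<le>Suc k. Q j) \<longleftrightarrow> Q 0 \<and> (\<forall>j\<le>k. Q (Suc j))" for Q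
      using less_Suc_eq_0_disj by (auto simp: less_Suc_eq_le[symmetric])
    have "emeasure ?S {w\<in>space ?S. \<forall>j\<le>Suc k. walk s w j = i j} =
        (\<integral>\<^sup>+f. emeasure ?S {w\<in>space ?S. f ## w \<in> {w\<in>space ?S. \<forall>j\<le>Suc k. walk s w j = i j}} \<partial>measure_pmf D)"
      by (rule prob_space.emeasure_stream_space[OF prob_space_measure_pmf m])
    also have "\<dots> = (\<integral>\<^sup>+f. (if s = i 0 then ennreal (\<Prod>j<k. P $ i (Suc j) $ i (Suc (Suc j))) else 0) * indicator {i (Suc 0)} (f s) \<partial>measure_pmf D)"
    proof (rule nn_integral_cong)
      fix f
      have "{w\<in>space ?S. f ## w \<in> {w\<in>space ?S. \<forall>j\<le>Suc k. walk s w j = i j}} =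
        (if s = i 0 then {w\<in>space ?S. \<forall>j\<le>k. walk (f s) w j = i (Suc j)} else {})"
        by (simp add: spS sp)
      then show "emeasure ?S {w\<in>space ?S. f ## w \<in> {w\<in>space ?S. \<forall>j\<le>Suc k. walk s w j = i j}} =
        (if s = i 0 then ennreal (\<Prod>j<k. P $ i (Suc j) $ i (Suc (Suc j))) else 0) * indicator {i (Suc 0)} (f s)"
        using Suc[of "f s" "\<lambda>j. i (Suc j)"] by (cases "s = i 0") (simp_all only: if_True if_False simp_thms, auto)
    qed
    also have "\<dots> = (if s = i 0 then ennreal (\<Prod>j<k. P $ i (Suc j) $ i (Suc (Suc j))) else 0) *
        (\<integral>\<^sup>+x. indicator {i (Suc 0)} x \<partial>measure_pmf (map_pmf (\<lambda>f. f s) D))"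
      by (subst nn_integral_cmult) auto
    also have "(\<integral>\<^sup>+x. indicator {i (Suc 0)} x \<partial>measure_pmf (map_pmf (\<lambda>f. f s) D)) = ennreal (P $ s $ i (Suc 0))"
      unfolding Dc by (simp add: emeasure_pmf_single r)
    finally show ?case
      by (auto simp: prod.lessThan_Suc_shift ennreal_mult nn prod_nonneg mult.commute simp del: prod.lessThan_Suc)
  qed
  have "dtmc_process ?S (\<lambda>k w. walk s0 w k) s0 P"
    unfolding dtmc_process_def
  proof (intro conjI allI)
    show "prob_space ?S" by (rule S.prob_space_axioms)
    fix k i
    show "measure ?S {w \<in> space ?S. \<forall>j\<le>Suc k. walk s0 w j = i j} =
        measure ?S {w \<in> space ?S. \<forall>j\<le>k. walk s0 w j = i j} * P $ i k $ i (Suc k)"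
      unfolding measure_def cyl by (simp add: nn prod_nonneg)
  qed auto
  then show ?thesis by blast
qed

section \<open>Jump linear systems\<close>

primrec jls_state :: "('s \<Rightarrow> real ^ 'n ^ 'n) \<Rightarrow> (nat \<Rightarrow> 's) \<Rightarrow> real ^ 'n::finite \<Rightarrow> nat \<Rightarrow> real ^ 'n" where
  "jls_state A s x0 0 = x0"
| "jls_state A s x0 (Suc k) = A (s k) *v jls_state A s x0 k"

definition stable_with_probability_one ::
  "'w measure \<Rightarrow> (nat \<Rightarrow> 'w \<Rightarrow> 's) \<Rightarrow> ('s \<Rightarrow> real ^ 'n ^ 'n::finite) \<Rightarrow> bool" where
  "stable_with_probability_one W X A \<longleftrightarrow>
     (\<forall>x0. AE w in W. (\<lambda>k. infnorm (jls_state A (\<lambda>j. X j w) x0 k)) \<longlonglongrightarrow> 0)"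

definition lyapunov_candidate :: "('s \<Rightarrow> real ^ 'n::finite \<Rightarrow> real) \<Rightarrow> bool" where
  "lyapunov_candidate V \<longleftrightarrow>
     (\<forall>s. continuous_on UNIV (V s) \<and> filterlim (V s) at_top at_infinity \<and>
          V s 0 = 0 \<and> (\<forall>x. x \<noteq> 0 \<longrightarrow> 0 < V s x))"

definition stability_constants :: "('s \<Rightarrow> real ^ 'n ^ 'n::finite) \<Rightarrow> real \<Rightarrow> real \<Rightarrow> bool" where
  "stability_constants A \<alpha> \<mu> \<longleftrightarrow>
     0 < \<alpha> \<and> \<alpha> < 1 \<and> 1 < \<mu> \<and>
     (\<exists>V. lyapunov_candidate V \<and>
          (\<forall>s x. V s (A s *v x) - V s x \<le> - \<alpha> * V s x) \<and>
          (\<forall>s s' x. V s x \<le> \<mu> * V s' x))"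

section \<open>The linear optimization problem\<close>

definition lp_feasible ::
  "('s, 'a) mdp \<Rightarrow> real \<Rightarrow> real \<Rightarrow> real \<Rightarrow>
     real ^ 'a ^ 's \<Rightarrow> real ^ 's \<Rightarrow> real ^ 's ^ 's \<Rightarrow> bool" where
  "lp_feasible (M :: ('s::finite, 'a::finite) mdp) \<alpha> \<mu> \<epsilon> \<pi>h p Ph \<longleftrightarrow>
     \<pi>h *v 1 = p \<and>
     1 \<bullet> p = 1 \<and>
     transpose Ph *v 1 = p \<and>
     (\<forall>i j. Ph $ i $ j = (\<Sum>a\<in>UNIV. transition M i a j * \<pi>h $ i $ a)) \<and>
     1 - trace Ph < ln (1 / (1 - \<alpha>)) / ln \<mu> \<and>
     (\<forall>i a. 0 \<le> \<pi>h $ i $ a) \<and>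
     (\<forall>i. \<epsilon> \<le> p $ i)"

definition lp_optimal ::
  "('s, 'a) mdp \<Rightarrow> ('s \<Rightarrow> real) \<Rightarrow> real \<Rightarrow> real \<Rightarrow> real \<Rightarrow>
     real ^ 'a ^ 's \<Rightarrow> real ^ 's \<Rightarrow> real ^ 's ^ 's \<Rightarrow> bool" where
  "lp_optimal (M :: ('s::finite, 'a::finite) mdp) c \<alpha> \<mu> \<epsilon> \<pi>h p Ph \<longleftrightarrow>
     lp_feasible M \<alpha> \<mu> \<epsilon> \<pi>h p Ph \<and>
     (\<forall>\<pi>h' p' Ph'. lp_feasible M \<alpha> \<mu> \<epsilon> \<pi>h' p' Ph' \<longrightarrow>
        (\<Sum>s\<in>UNIV. c s * p $ s) \<le> (\<Sum>s\<in>UNIV. c s * p' $ s))"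

definition diag_matrix :: "real ^ 's \<Rightarrow> real ^ 's ^ 's::finite" where
  "diag_matrix v = (\<chi> i j. if i = j then v $ i else 0)"

end

(*
  The flow constraints make pi a policy and p a strictly positive
  invariant vector of P, so all states are recurrent and P is irreducible. The trace constraint says
  that the stationary frequency of mode switches stays below the rate at which the decay factor
  1 - alpha beats the jump factor mu. The law of large numbers is replaced by an exponential moment
  bound: after correction by a solution of the Poisson equation, the drift of the logarithm of the
  Lyapunov bound is negative at every state, so its exponential moments decay geometrically for a
  small exponent and the bound tends to 0 almost surely.
*)
theory Submission
  imports Defs
begin

section \<open>Stochastic matrices with a positive invariant vector\<close>

definition stochastic :: "real ^ 's ^ 's::finite \<Rightarrow> bool" where
  "stochastic P \<longleftrightarrow> (\<forall>i j. 0 \<le> P $ i $ j) \<and> (\<forall>i. (\<Sum>j\<in>UNIV. P $ i $ j) = 1)"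

lemma matrix_pow_nonneg:
  assumes "stochastic P"
  shows "0 \<le> matrix_pow P n $ i $ j"
proof (induction n arbitrary: i)
  case 0
  show ?case by (simp add: matrix_pow_def mat_def)
next
  case (Suc n)
  have "matrix_pow P (Suc n) = P ** matrix_pow P n"
    by (simp add: matrix_pow_def)
  then show ?case
    using assms Suc by (auto simp: matrix_matrix_mult_def stochastic_def intro!: sum_nonneg)
qed

lemma invariant_matrix_pow:
  assumes "z v* P = z"
  shows "z v* matrix_pow P n = z"
proof (induction n)
  case (Suc n)
  have "matrix_pow P (Suc n) = P ** matrix_pow P n"
    by (simp add: matrix_pow_def)
  then show ?case
    using assms Suc by (metis vector_matrix_mul_assoc)
qed (simp add: matrix_pow_def vector_matrix_mul_rid)

section \<open>First passage and recurrence\<close>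

lemma first_passage_nonneg:
  assumes "stochastic P"
  shows "0 \<le> first_passage P n i j"
  using assms by (induction n arbitrary: i) (auto simp: stochastic_def intro!: sum_nonneg)

text \<open>First visits to \<open>j\<close> at different times are disjoint events. Splitting off
  the first step bounds the sum by a row sum of \<open>P\<close>; the induction treats all starting
  states at once.\<close>

lemma sum_first_passage_le_1:
  assumes "stochastic P"
  shows "(\<Sum>n<N. first_passage P n i j) \<le> 1"
proof (induction N arbitrary: i)
  case (Suc N)
  have "(\<Sum>n<Suc N. first_passage P n i j) =
      P $ i $ j + (\<Sum>k\<in>UNIV - {j}. P $ i $ k * (\<Sum>n<N. first_passage P n k j))"
    by (simp add: sum.lessThan_Suc_shift sum_distrib_left sum.swap[of _ _ "{..<N}"] del: sum.lessThan_Suc)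
  also have "\<dots> \<le> P $ i $ j + (\<Sum>k\<in>UNIV - {j}. P $ i $ k * 1)"
    using assms Suc by (intro add_mono sum_mono mult_left_mono) (auto simp: stochastic_def)
  also have "\<dots> = (\<Sum>k\<in>UNIV. P $ i $ k)"
    by (simp add: sum.remove[of UNIV j])
  finally show ?case
    using assms by (simp add: stochastic_def)
qed simp

text \<open>
  Let \<open>u n\<close> be the probability that the chain started from \<open>p\<close> first visits \<open>i\<close> at time \<open>n + 1\<close>.
  By invariance the return time law of \<open>i\<close> is \<open>(u n - u (n + 1)) / p i\<close>, which telescopes.
\<close>

lemma recurrent_of_positive_invariant:
  assumes P: "stochastic P"
    and p: "p v* P = p" "\<And>s. 0 < p $ s" "(\<Sum>s\<in>UNIV. p $ s) = 1"
  shows "recurrent P i"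
proof -
  define u where "u n = (\<Sum>j\<in>UNIV. p $ j * first_passage P n j i)" for n
  have inv: "(\<Sum>j\<in>UNIV. p $ j * P $ j $ k) = p $ k" for k
    using arg_cong[OF p(1), of "\<lambda>v. v $ k"] by (simp add: vector_matrix_mult_def)
  have u0: "u 0 = p $ i"
    by (simp add: u_def inv)
  \<comment> \<open>Invariance absorbs the first step: after it the chain is again distributed by
    \<open>p\<close>. The omitted state \<open>i\<close>, where the visit would come too early,
    gives the correction term.\<close>
  have u_Suc: "u (Suc n) = u n - p $ i * first_passage P n i i" for n
  proof -
    have "u (Suc n) = (\<Sum>k\<in>UNIV - {i}. (\<Sum>j\<in>UNIV. p $ j * P $ j $ k) * first_passage P n k i)"
      by (simp add: u_def sum_distrib_left sum_distrib_right mult.assoc sum.swap[of _ _ "UNIV - {i}"])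
    also have "\<dots> = u n - p $ i * first_passage P n i i"
      by (simp add: inv u_def sum.remove[of UNIV i])
    finally show ?thesis .
  qed
  have u_nonneg: "0 \<le> u n" for n
    using p(2) first_passage_nonneg[OF P] by (auto simp: u_def less_imp_le intro!: sum_nonneg)
  \<comment> \<open>Disjointness makes the series of \<open>u\<close> converge, so \<open>u\<close>
    tends to 0 and the telescoped return probabilities sum to exactly 1.\<close>
  have "(\<Sum>n<N. u n) \<le> 1" for N
  proof -
    have "(\<Sum>n<N. u n) = (\<Sum>j\<in>UNIV. p $ j * (\<Sum>n<N. first_passage P n j i))"
      by (simp add: u_def sum_distrib_left sum.swap[of _ _ "{..<N}"])
    also have "\<dots> \<le> (\<Sum>j\<in>UNIV. p $ j * 1)"
      using p(2) sum_first_passage_le_1[OF P] by (intro sum_mono mult_left_mono) (auto simp: less_imp_le)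
    finally show ?thesis using p(3) by simp
  qed
  then have "summable u"
    using u_nonneg by (intro summableI_nonneg_bounded) auto
  then have "u \<longlonglongrightarrow> 0"
    by (rule summable_LIMSEQ_zero)
  then have "(\<lambda>n. 1 - u n / p $ i) \<longlonglongrightarrow> 1 - 0 / p $ i"
    using p(2)[of i] by (intro tendsto_intros) auto
  moreover have "(\<Sum>n<N. first_passage P n i i) = 1 - u N / p $ i" for N
    using p(2)[of i] by (induction N) (auto simp: u0 u_Suc field_simps)
  ultimately show ?thesis
    by (simp add: recurrent_def sums_def)
qed

text \<open>A positive invariant vector makes every state recurrent, so no state lies outside the
  single ergodic class, and paths can be joined at its representative \<open>i0\<close>.\<close>

lemma irreducible_of_positive_invariant:
  assumes "ergodic_unichain P" "stochastic P"
    and "p v* P = p" "\<And>s. 0 < p $ s" "(\<Sum>s\<in>UNIV. p $ s) = 1"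
  shows "accessible P i j"
proof -
  obtain C i0 where C: "C = {j. communicate P i0 j}" and "\<forall>i. i \<notin> C \<longrightarrow> transient P i"
    using assms(1) by (auto simp: ergodic_unichain_def ergodic_class_def)
  with recurrent_of_positive_invariant[OF assms(2-)] have "UNIV = C"
    by (auto simp: transient_def)
  with C have "accessible P i i0" "accessible P i0 j"
    by (auto simp: communicate_def)
  then obtain m n where mn: "0 < matrix_pow P m $ i $ i0" "0 < matrix_pow P n $ i0 $ j"
    by (auto simp: accessible_def)
  have "matrix_pow P (m + n) = matrix_pow P m ** matrix_pow P n"
    by (induction m) (simp_all add: matrix_pow_def matrix_mul_assoc)
  then have "matrix_pow P (m + n) $ i $ j = (\<Sum>k\<in>UNIV. matrix_pow P m $ i $ k * matrix_pow P n $ k $ j)"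
    by (simp add: matrix_matrix_mult_def)
  also have "\<dots> \<ge> matrix_pow P m $ i $ i0 * matrix_pow P n $ i0 $ j"
    using matrix_pow_nonneg[OF assms(2)] by (intro member_le_sum) auto
  finally have "0 < matrix_pow P (m + n) $ i $ j"
    using mn by (smt (verit) mult_pos_pos)
  then show ?thesis
    by (auto simp: accessible_def)
qed

text \<open>
  Subtracting the largest multiple of \<open>p\<close> that lies below \<open>z\<close> leaves a nonnegative invariant
  vector with a zero entry, and irreducibility spreads this zero to all entries.
\<close>

lemma invariant_multiple:
  fixes p z :: "real ^ 's::finite"
  assumes P: "stochastic P" and irr: "\<And>i j. accessible P i j"
    and p: "p v* P = p" "\<And>s. 0 < p $ s"
    and z: "z v* P = z"
  shows "\<exists>c. z = c *\<^sub>R p"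
proof -
  define c where "c = Min (range (\<lambda>s. z $ s / p $ s))"
  have "c \<in> range (\<lambda>s. z $ s / p $ s)"
    unfolding c_def by (intro Min_in) auto
  then obtain i where i: "c = z $ i / p $ i"
    by auto
  define r where "r = z - c *\<^sub>R p"
  have "c \<le> z $ s / p $ s" for s
    unfolding c_def by (intro Min_le) auto
  then have r_nonneg: "0 \<le> r $ s" for s
    by (simp add: r_def pos_le_divide_eq p(2))
  have "r $ i = 0"
    using p(2)[of i] by (simp add: r_def i)
  have "r v* P = r"
    by (simp add: r_def vector_matrix_mult_diff_distrib scaleR_vector_matrix_assoc p(1) z)
  have "r $ j = 0" for j
  proof -
    obtain n where n: "0 < matrix_pow P n $ j $ i"
      using irr by (auto simp: accessible_def)
    have "r $ j * matrix_pow P n $ j $ i \<le> (\<Sum>k\<in>UNIV. r $ k * matrix_pow P n $ k $ i)"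
      using matrix_pow_nonneg[OF P] r_nonneg by (intro member_le_sum) auto
    also have "\<dots> = (r v* matrix_pow P n) $ i"
      by (simp add: vector_matrix_mult_def)
    also have "\<dots> = 0"
      by (simp add: invariant_matrix_pow[OF \<open>r v* P = r\<close>] \<open>r $ i = 0\<close>)
    finally show ?thesis
      using n r_nonneg[of j] by (simp add: mult_le_0_iff)
  qed
  then have "z = c *\<^sub>R p"
    by (simp add: r_def vec_eq_iff)
  then show ?thesis ..
qed

text \<open>Fredholm alternative: the orthogonal complement of the range of \<open>I - P\<close>
  consists of the left fixed vectors of \<open>P\<close>, which are the multiples of
  \<open>p\<close>. The component \<open>z\<close> of \<open>v\<close> in that complement is also
  orthogonal to \<open>p\<close>, hence zero.\<close>

lemma poisson_equation_solvable:
  fixes p v :: "real ^ 's::finite"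
  assumes P: "stochastic P" and irr: "\<And>i j. accessible P i j"
    and p: "p v* P = p" "\<And>s. 0 < p $ s"
    and v: "p \<bullet> v = 0"
  shows "\<exists>h. h - P *v h = v"
proof -
  let ?L = "\<lambda>h. h - P *v h"
  have "linear ?L"
    by (intro linear_compose_sub linear_ident matrix_vector_mul_linear)
  then have span: "span (range ?L) = range ?L"
    by (simp add: linear_subspace_image span_eq_iff)
  obtain y z where y: "y \<in> range ?L" and z: "\<And>w. w \<in> range ?L \<Longrightarrow> orthogonal z w" and yz: "v = y + z"
    using orthogonal_subspace_decomp_exists[of "range ?L" v] unfolding span by blast
  have "(z - z v* P) \<bullet> h = z \<bullet> ?L h" for h
    by (simp add: inner_diff_left inner_diff_right dot_lmul_matrix)
  then have "(z - z v* P) \<bullet> h = 0" for h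
    using z by (simp add: orthogonal_def)
  then have "z v* P = z"
    using inner_eq_zero_iff[of "z - z v* P"] by simp
  then obtain c where c: "z = c *\<^sub>R p"
    using invariant_multiple[OF P irr p] by blast
  have "p \<bullet> y = 0"
    using y by (auto simp: inner_diff_right dot_lmul_matrix[symmetric] p(1))
  with v yz have "p \<bullet> z = 0"
    by (simp add: inner_add_right)
  then have "z = 0"
    by (simp add: c)
  with y yz show ?thesis
    by force
qed

section \<open>Additive functionals of a Markov chain\<close>

text \<open>The mean of the product up to time \<open>k\<close> is \<open>a k\<close>, a finite sum
  over paths, and the Markov property makes it shrink by the factor \<rho> at each step. The means
  are summable, so almost surely the products are summable and tend to 0.\<close>

lemma dtmc_prod_tendsto_0:
  fixes e :: "'s::finite \<Rightarrow> 's \<Rightarrow> real"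
  assumes X: "dtmc_process W X s0 P"
    and e: "\<And>i j. 0 \<le> e i j"
    and \<rho>: "0 \<le> \<rho>" "\<rho> < 1" "\<And>i. (\<Sum>j\<in>UNIV. P $ i $ j * e i j) \<le> \<rho>"
  shows "AE w in W. (\<lambda>k. \<Prod>j<k. e (X j w) (X (Suc j) w)) \<longlonglongrightarrow> 0"
proof -
  interpret prob_space W
    using X by (simp add: dtmc_process_def)
  have X_meas [measurable]: "X k \<in> measurable W (count_space UNIV)" for k
    using X by (simp add: dtmc_process_def)
  define cyl where "cyl k i = {w \<in> space W. \<forall>j\<le>k. X j w = i j}" for k i
  \<comment> \<open>Extensionality fixes the values beyond time \<open>k\<close>, so there is
    exactly one path for each choice of states up to time \<open>k\<close>.\<close>
  define paths :: "nat \<Rightarrow> (nat \<Rightarrow> 's) set" where "paths k = PiE {..k} (\<lambda>_. UNIV)" for k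
  define wt where "wt k i = (\<Prod>j<k. e (i j) (i (Suc j)))" for k i
  define a where "a k = (\<Sum>i\<in>paths k. prob (cyl k i) * wt k i)" for k
  have cyl_sets [measurable]: "cyl k i \<in> sets W" for k i
    unfolding cyl_def by measurable
  have fin: "finite (paths k)" for k
    unfolding paths_def by (intro finite_PiE) auto
  have wt_nonneg: "0 \<le> wt k i" for k i
    unfolding wt_def by (intro prod_nonneg) (auto simp: e)
  have step: "prob (cyl (Suc k) i) = prob (cyl k i) * P $ i k $ i (Suc k)" for k i
    using X unfolding cyl_def by (simp add: dtmc_process_def)
  have a_Suc: "a (Suc k) \<le> \<rho> * a k" for k
  proof -
    have ins: "{..Suc k} = insert (Suc k) {..k}" by auto
    have paths_Suc: "paths (Suc k) = (\<lambda>(y, i). i(Suc k := y)) ` (UNIV \<times> paths k)"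
      unfolding paths_def ins by (rule PiE_insert_eq)
    have inj: "inj_on (\<lambda>(y, i). i(Suc k := y)) (UNIV \<times> paths k)"
      unfolding paths_def by (rule inj_combinator) auto
    \<comment> \<open>Extending a path by \<open>y\<close> at time \<open>Suc k\<close> leaves its
      cylinder up to time \<open>k\<close> unchanged and adds one factor to the weight.\<close>
    have split: "prob (cyl (Suc k) (i(Suc k := y))) * wt (Suc k) (i(Suc k := y)) =
        prob (cyl k i) * wt k i * (P $ i k $ y * e (i k) y)" for i y
    proof -
      have "cyl k (i(Suc k := y)) = cyl k i"
        by (auto simp: cyl_def)
      moreover have "wt (Suc k) (i(Suc k := y)) = wt k i * e (i k) y"
        by (simp add: wt_def)
      ultimately show ?thesis
        by (simp add: step)
    qed
    have "a (Suc k) = (\<Sum>(y, i)\<in>UNIV \<times> paths k. prob (cyl k i) * wt k i * (P $ i k $ y * e (i k) y))"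
      unfolding a_def paths_Suc by (subst sum.reindex[OF inj]) (simp add: case_prod_unfold split)
    also have "\<dots> = (\<Sum>i\<in>paths k. prob (cyl k i) * wt k i * (\<Sum>y\<in>UNIV. P $ i k $ y * e (i k) y))"
      by (simp add: sum.cartesian_product[symmetric] sum.swap[of _ "paths k"] sum_distrib_left)
    also have "\<dots> \<le> (\<Sum>i\<in>paths k. prob (cyl k i) * wt k i * \<rho>)"
      by (intro sum_mono mult_left_mono \<rho>) (simp add: wt_nonneg)
    also have "\<dots> = \<rho> * a k"
      by (simp add: a_def sum_distrib_left mult.commute)
    finally show ?thesis .
  qed
  have a_nonneg: "0 \<le> a k" for k
    unfolding a_def by (intro sum_nonneg) (simp add: wt_nonneg)
  have a_le: "a k \<le> a 0 * \<rho> ^ k" for k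
  proof (induction k)
    case (Suc k)
    then show ?case
      using a_Suc[of k] mult_left_mono[OF Suc \<rho>(1)] by (simp add: algebra_simps)
  qed simp
  have integral: "(\<integral>\<^sup>+w. ennreal (wt k (\<lambda>j. X j w)) \<partial>W) = ennreal (a k)" for k
  proof -
    have "ennreal (wt k (\<lambda>j. X j w)) = (\<Sum>i\<in>paths k. ennreal (wt k i) * indicator (cyl k i) w)"
      if w: "w \<in> space W" for w
    proof -
      \<comment> \<open>The path followed by \<open>w\<close> up to time \<open>k\<close>: its
        cylinder is the only one that contains \<open>w\<close>.\<close>
      let ?i = "restrict (\<lambda>j. X j w) {..k}"
      have "?i \<in> paths k"
        by (simp add: paths_def)
      have eq: "w \<in> cyl k i \<longleftrightarrow> i = ?i" if "i \<in> paths k" for i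
        using that w by (auto simp: cyl_def paths_def PiE_iff extensional_def restrict_def fun_eq_iff)
      have "(\<Sum>i\<in>paths k. ennreal (wt k i) * indicator (cyl k i) w) =
          (\<Sum>i\<in>paths k. if i = ?i then ennreal (wt k i) else 0)"
        by (intro sum.cong) (auto simp: eq indicator_def)
      also have "\<dots> = ennreal (wt k ?i)"
        using fin \<open>?i \<in> paths k\<close> by (simp add: sum.delta)
      also have "wt k ?i = wt k (\<lambda>j. X j w)"
        by (simp add: wt_def)
      finally show ?thesis by simp
    qed
    then have "(\<integral>\<^sup>+w. ennreal (wt k (\<lambda>j. X j w)) \<partial>W) =
        (\<integral>\<^sup>+w. (\<Sum>i\<in>paths k. ennreal (wt k i) * indicator (cyl k i) w) \<partial>W)"
      by (intro nn_integral_cong) auto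
    also have "\<dots> = (\<Sum>i\<in>paths k. ennreal (wt k i) * emeasure W (cyl k i))"
      by (simp add: nn_integral_sum nn_integral_cmult)
    also have "\<dots> = (\<Sum>i\<in>paths k. ennreal (prob (cyl k i) * wt k i))"
      by (simp add: emeasure_eq_measure ennreal_mult wt_nonneg mult.commute)
    finally show ?thesis
      by (simp add: a_def wt_nonneg sum_ennreal)
  qed
  have wt_meas [measurable]: "(\<lambda>w. wt k (\<lambda>j. X j w)) \<in> borel_measurable W" for k
  proof -
    have "(\<lambda>w. e (X j w) (X (Suc j) w)) \<in> borel_measurable W" for j
    proof -
      have "(\<lambda>w. e i (X (Suc j) w)) \<in> borel_measurable W" for i
        by (rule measurable_compose[OF X_meas]) simp
      then show ?thesis
        by (rule measurable_compose_countable[OF _ X_meas])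
    qed
    then show ?thesis
      unfolding wt_def by (intro borel_measurable_prod) auto
  qed
  have "summable (\<lambda>k. a 0 * \<rho> ^ k)"
    using \<rho> by (intro summable_mult summable_geometric) auto
  then have "summable a"
    by (rule summable_comparison_test'[where N = 0]) (auto simp: a_nonneg a_le)
  have "(\<integral>\<^sup>+w. (\<Sum>k. ennreal (wt k (\<lambda>j. X j w))) \<partial>W) = (\<Sum>k. ennreal (a k))"
    by (subst nn_integral_suminf) (auto simp: integral)
  also have "\<dots> \<noteq> \<infinity>"
    using \<open>summable a\<close> a_nonneg by (simp add: suminf_ennreal2)
  finally have "AE w in W. (\<Sum>k. ennreal (wt k (\<lambda>j. X j w))) \<noteq> \<infinity>"
    by (intro nn_integral_noteq_infinite) auto
  then show ?thesis
  proof eventually_elim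
    case (elim w)
    then have "summable (\<lambda>k. wt k (\<lambda>j. X j w))"
      by (intro summable_suminf_not_top) (auto simp: wt_nonneg)
    then show ?case
      unfolding wt_def by (rule summable_LIMSEQ_zero)
  qed
qed

text \<open>\<open>F i\<close> is the moment generating function of the increment out of
  \<open>i\<close>. It is 1 at 0 and its derivative there is the negative mean drift, so it drops
  below 1 to the right of 0. Finiteness of the state space gives one \<open>t\<close> and, as a
  maximum, one \<rho> for all states.\<close>

lemma exp_tilt:
  fixes d :: "'s::finite \<Rightarrow> 's \<Rightarrow> real"
  assumes P: "stochastic P"
    and d: "\<And>i. (\<Sum>j\<in>UNIV. P $ i $ j * d i j) < 0"
  obtains t \<rho> where "0 < t" "0 \<le> \<rho>" "\<rho> < 1"
    and "\<And>i. (\<Sum>j\<in>UNIV. P $ i $ j * exp (t * d i j)) \<le> \<rho>"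
proof -
  define F where "F i t = (\<Sum>j\<in>UNIV. P $ i $ j * exp (t * d i j))" for i t
  have "\<forall>\<^sub>F t in at_right 0. F i t < 1" for i
  proof -
    have "(F i has_real_derivative (\<Sum>j\<in>UNIV. P $ i $ j * d i j)) (at 0)"
      unfolding F_def by (auto intro!: derivative_eq_intros simp: mult.commute)
    then obtain r where r: "0 < r" "\<And>t. 0 < t \<Longrightarrow> t < r \<Longrightarrow> F i (0 + t) < F i 0"
      using DERIV_neg_dec_right[OF _ d] by blast
    have "F i 0 = 1"
      using P by (simp add: F_def stochastic_def)
    with r show ?thesis
      by (auto simp: eventually_at_right_field intro!: exI[of _ r])
  qed
  then have "\<forall>\<^sub>F t in at_right 0. \<forall>i\<in>UNIV. F i t < 1"
    by (intro eventually_ball_finite) auto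
  moreover have "\<forall>\<^sub>F t in at_right (0::real). 0 < t"
    by (simp add: eventually_at_right_less)
  ultimately have "\<forall>\<^sub>F t in at_right 0. 0 < t \<and> (\<forall>i. F i t < 1)"
    by eventually_elim simp
  then obtain t where t: "0 < t" "\<And>i. F i t < 1"
    using eventually_happens'[OF trivial_limit_at_right_real] by blast
  show thesis
  proof
    show "0 < t" by fact
    have "0 \<le> F i t" for i
      using P by (auto simp: F_def stochastic_def intro!: sum_nonneg)
    then show "0 \<le> Max (range (\<lambda>i. F i t))"
      by (auto simp: Max_ge_iff)
    show "Max (range (\<lambda>i. F i t)) < 1"
      using t by (subst Max_less_iff) auto
    show "(\<Sum>j\<in>UNIV. P $ i $ j * exp (t * d i j)) \<le> Max (range (\<lambda>i. F i t))" for i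
      unfolding F_def[symmetric] by (rule Max_ge) auto
  qed
qed

text \<open>
  A solution \<open>h\<close> of the Poisson equation turns the negative mean drift into a drift that is negative
  at every state, at the price of the bounded boundary term \<open>h (X k) - h (X 0)\<close>.
\<close>

lemma dtmc_sum_at_bot:
  fixes d :: "'s::finite \<Rightarrow> 's \<Rightarrow> real"
  assumes X: "dtmc_process W X s0 P"
    and P: "stochastic P" and irr: "\<And>i j. accessible P i j"
    and p: "p v* P = p" "\<And>s. 0 < p $ s" "(\<Sum>s\<in>UNIV. p $ s) = 1"
    and d: "(\<Sum>i\<in>UNIV. p $ i * (\<Sum>j\<in>UNIV. P $ i $ j * d i j)) < 0"
  shows "AE w in W. filterlim (\<lambda>k. \<Sum>j<k. d (X j w) (X (Suc j) w)) at_bot sequentially"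
proof -
  define g :: "real ^ 's" where "g = (\<chi> i. \<Sum>j\<in>UNIV. P $ i $ j * d i j)"
  \<comment> \<open>Centering at the stationary mean yields \<open>p \<bullet> v = 0\<close>, the
    solvability condition of the Poisson equation.\<close>
  define v :: "real ^ 's" where "v = (\<chi> i. g $ i - p \<bullet> g)"
  have drift: "p \<bullet> g < 0"
    using d by (simp add: g_def inner_vec_def)
  have "p \<bullet> v = 0"
    using p(3) by (simp add: v_def inner_vec_def right_diff_distrib sum_subtractf sum_distrib_right[symmetric])
  then obtain h where h: "h - P *v h = v"
    using poisson_equation_solvable[OF P irr p(1,2)] by blast
  define d' where "d' i j = d i j + h $ j - h $ i" for i j
  \<comment> \<open>The correction has conditional mean \<open>P *v h - h = - v\<close>, which
    replaces the local drift \<open>g\<close> by its stationary mean.\<close>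
  have "(\<Sum>j\<in>UNIV. P $ i $ j * d' i j) = p \<bullet> g" for i
  proof -
    have "(\<Sum>j\<in>UNIV. P $ i $ j * d' i j) =
        g $ i + (P *v h) $ i - (\<Sum>j\<in>UNIV. P $ i $ j) * h $ i"
      by (simp add: d'_def g_def matrix_vector_mult_def right_diff_distrib distrib_left sum.distrib sum_subtractf sum_distrib_right)
    also have "\<dots> = g $ i - v $ i"
      using P by (simp add: h[symmetric] stochastic_def)
    finally show ?thesis
      by (simp add: v_def)
  qed
  then obtain t \<rho> where t: "0 < t" and \<rho>: "0 \<le> \<rho>" "\<rho> < 1"
    "\<And>i. (\<Sum>j\<in>UNIV. P $ i $ j * exp (t * d' i j)) \<le> \<rho>"
    using exp_tilt[OF P, of d'] drift by metis
  have "AE w in W. (\<lambda>k. \<Prod>j<k. exp (t * d' (X j w) (X (Suc j) w))) \<longlonglongrightarrow> 0"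
    by (rule dtmc_prod_tendsto_0[OF X _ \<rho>]) simp
  then show ?thesis
  proof eventually_elim
    case (elim w)
    let ?S = "\<lambda>k. \<Sum>j<k. d (X j w) (X (Suc j) w)"
    have S': "(\<Sum>j<k. d' (X j w) (X (Suc j) w)) = ?S k + h $ X k w - h $ X 0 w" for k
      by (induction k) (simp_all add: d'_def)
    have lim: "(\<lambda>k. exp (t * (?S k + h $ X k w - h $ X 0 w))) \<longlonglongrightarrow> 0"
      using elim by (simp add: exp_sum[symmetric] sum_distrib_left[symmetric] S')
    define B where "B = Max (range (\<lambda>s. \<bar>h $ s\<bar>))"
    have B: "\<bar>h $ s\<bar> \<le> B" for s
      unfolding B_def by (intro Max_ge) auto
    show ?case
      unfolding filterlim_at_bot
    proof
      fix Z :: real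
      \<comment> \<open>The margin \<open>2 * B\<close> covers the boundary term.\<close>
      have "\<forall>\<^sub>F k in sequentially. exp (t * (?S k + h $ X k w - h $ X 0 w)) < exp (t * (Z - 2 * B))"
        using lim by (rule order_tendstoD) simp
      then show "\<forall>\<^sub>F k in sequentially. ?S k \<le> Z"
      proof eventually_elim
        case (elim k)
        then have "?S k + h $ X k w - h $ X 0 w < Z - 2 * B"
          using t by simp
        then show ?case
          using B[of "X k w"] B[of "X 0 w"] by linarith
      qed
    qed
  qed
qed

section \<open>Lyapunov functions\<close>

text \<open>Away from the \<delta>-ball \<open>V\<close> has a positive lower bound: its minimum on
  a compact shell, and 1 from radius \<open>R\<close> on by radial unboundedness. Small values of
  \<open>V\<close> therefore force small \<open>x\<close>.\<close>

lemma tendsto_0_of_lyapunov: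
  fixes V :: "real ^ 'n::finite \<Rightarrow> real"
  assumes cont: "continuous_on UNIV V" and unb: "filterlim V at_top at_infinity"
    and pos: "\<And>x. x \<noteq> 0 \<Longrightarrow> 0 < V x"
    and lim: "(\<lambda>k. V (x k)) \<longlonglongrightarrow> 0"
  shows "x \<longlonglongrightarrow> 0"
proof (rule tendstoI)
  fix \<delta> :: real
  assume \<delta>: "0 < \<delta>"
  obtain R where R: "\<And>y. R \<le> norm y \<Longrightarrow> 1 \<le> V y"
    using unb by (auto simp: filterlim_at_top eventually_at_infinity)
  define K where "K = cball 0 R - ball (0 :: real ^ 'n) \<delta>"
  have "compact K"
    unfolding K_def by (intro compact_diff) auto
  have "\<exists>m>0. \<forall>y\<in>K. m \<le> V y"
  proof (cases "K = {}")
    case True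
    then show ?thesis by (auto intro: exI[of _ 1])
  next
    case False
    then obtain y where y: "y \<in> K" "\<And>y'. y' \<in> K \<Longrightarrow> V y \<le> V y'"
      using continuous_attains_inf[OF \<open>compact K\<close>] continuous_on_subset[OF cont] by blast
    then have "y \<noteq> 0"
      using \<delta> by (auto simp: K_def)
    with y pos show ?thesis by blast
  qed
  then obtain m where m: "0 < m" "\<And>y. y \<in> K \<Longrightarrow> m \<le> V y"
    by blast
  have "\<forall>\<^sub>F k in sequentially. V (x k) < min m 1"
    using lim by (rule order_tendstoD) (use m in auto)
  then show "\<forall>\<^sub>F k in sequentially. dist (x k) 0 < \<delta>"
  proof eventually_elim
    case (elim k)
    then have "norm (x k) < R" "x k \<notin> K"
      using R[of "x k"] m(2)[of "x k"] by (auto simp: not_le[symmetric])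
    then show ?case
      by (simp add: K_def)
  qed
qed

text \<open>One step contributes a factor \<open>1 - \<alpha>\<close> from the decay and a further
  \<mu> if the mode changes. This factor is \<open>exp (ln \<mu> * d i j)\<close>, where
  \<open>d\<close> is the switch indicator minus the break-even switching rate.\<close>

lemma jls_lyapunov_bound:
  fixes \<alpha> \<mu> :: real
  assumes decay: "\<And>s x. V s (A s *v x) - V s x \<le> - \<alpha> * V s x"
    and switch: "\<And>s s' x. V s x \<le> \<mu> * V s' x"
    and "\<alpha> < 1" "1 < \<mu>"
    and d: "\<And>i j. d i j = (if i = j then 0 else 1) - ln (1 / (1 - \<alpha>)) / ln \<mu>"
  shows "V (\<sigma> k) (jls_state A \<sigma> x0 k) \<le> exp (ln \<mu> * (\<Sum>j<k. d (\<sigma> j) (\<sigma> (Suc j)))) * V (\<sigma> 0) x0"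
proof (induction k)
  case (Suc k)
  let ?x = "jls_state A \<sigma> x0 k"
  have factor: "exp (ln \<mu> * d i j) = (if i = j then 1 else \<mu>) * (1 - \<alpha>)" for i j
  proof -
    have "ln \<mu> * d i j = (if i = j then 0 else ln \<mu>) + ln (1 - \<alpha>)"
      using \<open>\<alpha> < 1\<close> \<open>1 < \<mu>\<close> by (simp add: d ln_divide_pos field_simps)
    then show ?thesis
      using \<open>\<alpha> < 1\<close> \<open>1 < \<mu>\<close> by (simp add: exp_add)
  qed
  have "V (\<sigma> (Suc k)) (A (\<sigma> k) *v ?x) \<le>
      (if \<sigma> k = \<sigma> (Suc k) then 1 else \<mu>) * V (\<sigma> k) (A (\<sigma> k) *v ?x)"
    using switch by auto
  also have "\<dots> \<le> (if \<sigma> k = \<sigma> (Suc k) then 1 else \<mu>) * ((1 - \<alpha>) * V (\<sigma> k) ?x)"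
    using decay[of "\<sigma> k" ?x] \<open>1 < \<mu>\<close> by (intro mult_left_mono) (auto simp: algebra_simps)
  also have "\<dots> = exp (ln \<mu> * d (\<sigma> k) (\<sigma> (Suc k))) * V (\<sigma> k) ?x"
    by (simp only: factor mult.assoc)
  also have "\<dots> \<le> exp (ln \<mu> * d (\<sigma> k) (\<sigma> (Suc k))) *
      (exp (ln \<mu> * (\<Sum>j<k. d (\<sigma> j) (\<sigma> (Suc j)))) * V (\<sigma> 0) x0)"
    by (intro mult_left_mono Suc) simp
  also have "\<dots> = exp (ln \<mu> * (\<Sum>j<Suc k. d (\<sigma> j) (\<sigma> (Suc j)))) * V (\<sigma> 0) x0"
    by (simp add: distrib_left exp_add)
  finally show ?case by simp
qed simp

text \<open>The stationary mean of \<open>d\<close> is the switching frequency minus the break-even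
  rate, negative by the last hypothesis. So the sums of \<open>d\<close> tend to minus infinity and
  the Lyapunov bound tends to 0.\<close>

lemma mjls_stable:
  fixes A :: "'s::finite \<Rightarrow> real ^ 'n::finite ^ 'n"
  assumes stab: "stability_constants A \<alpha> \<mu>"
    and X: "dtmc_process W X s0 P"
    and P: "stochastic P" and irr: "\<And>i j. accessible P i j"
    and p: "p v* P = p" "\<And>s. 0 < p $ s" "(\<Sum>s\<in>UNIV. p $ s) = 1"
    and rate: "1 - (\<Sum>s\<in>UNIV. p $ s * P $ s $ s) < ln (1 / (1 - \<alpha>)) / ln \<mu>"
  shows "stable_with_probability_one W X A"
proof -
  obtain V where V: "lyapunov_candidate V"
    and decay: "\<And>s x. V s (A s *v x) - V s x \<le> - \<alpha> * V s x"
    and switch: "\<And>s s' x. V s x \<le> \<mu> * V s' x"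
    and \<alpha>\<mu>: "\<alpha> < 1" "1 < \<mu>"
    using stab unfolding stability_constants_def by blast
  define b where "b = ln (1 / (1 - \<alpha>)) / ln \<mu>"
  define d where "d i j = (if i = j then 0 else 1) - b" for i j :: 's
  have "(\<Sum>j\<in>UNIV. P $ i $ j * d i j) = 1 - P $ i $ i - b" for i
  proof -
    have "(\<Sum>j\<in>UNIV. P $ i $ j * d i j) = (\<Sum>j\<in>UNIV. P $ i $ j * (1 - b) - (if j = i then P $ i $ j else 0))"
      by (intro sum.cong) (auto simp: d_def algebra_simps)
    also have "\<dots> = (\<Sum>j\<in>UNIV. P $ i $ j) * (1 - b) - P $ i $ i"
      by (simp add: sum_subtractf sum_distrib_right)
    finally show ?thesis
      using P by (simp add: stochastic_def)
  qed
  then have "(\<Sum>i\<in>UNIV. p $ i * (\<Sum>j\<in>UNIV. P $ i $ j * d i j)) =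
      (\<Sum>i\<in>UNIV. p $ i * (1 - b) - p $ i * P $ i $ i)"
    by (simp only:) (simp add: algebra_simps)
  also have "\<dots> = (\<Sum>i\<in>UNIV. p $ i) * (1 - b) - (\<Sum>i\<in>UNIV. p $ i * P $ i $ i)"
    by (simp only: sum_subtractf sum_distrib_right)
  also have "\<dots> < 0"
    using rate by (simp add: p(3) b_def)
  finally have AE: "AE w in W. filterlim (\<lambda>k. \<Sum>j<k. d (X j w) (X (Suc j) w)) at_bot sequentially"
    by (intro dtmc_sum_at_bot[OF X P irr p])
  show ?thesis
    unfolding stable_with_probability_one_def
  proof
    fix x0 :: "real ^ 'n"
    show "AE w in W. (\<lambda>k. infnorm (jls_state A (\<lambda>j. X j w) x0 k)) \<longlonglongrightarrow> 0"
      using AE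
    proof eventually_elim
      case (elim w)
      let ?x = "jls_state A (\<lambda>j. X j w) x0"
      let ?E = "\<lambda>k. exp (ln \<mu> * (\<Sum>j<k. d (X j w) (X (Suc j) w)))"
      have "filterlim (\<lambda>k. ln \<mu> * (\<Sum>j<k. d (X j w) (X (Suc j) w))) at_bot sequentially"
        using \<alpha>\<mu>(2) by (intro filterlim_tendsto_pos_mult_at_bot[OF tendsto_const _ elim]) simp
      then have "?E \<longlonglongrightarrow> 0"
        by (rule filterlim_compose[OF exp_at_bot])
      then have E: "(\<lambda>k. \<mu> * (?E k * V (X 0 w) x0)) \<longlonglongrightarrow> \<mu> * (0 * V (X 0 w) x0)"
        by (intro tendsto_intros)
      have V_nonneg: "0 \<le> V s0 x" for x
        using V by (cases "x = 0") (auto simp: lyapunov_candidate_def less_imp_le)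
      \<comment> \<open>\<open>V (X k w)\<close> varies with the mode; one more factor \<mu> passes
        to the fixed function \<open>V s0\<close>, from which convergence of the state can be read
        off.\<close>
      have bound: "V s0 (?x k) \<le> \<mu> * (?E k * V (X 0 w) x0)" for k
      proof -
        have "V s0 (?x k) \<le> \<mu> * V (X k w) (?x k)"
          by (rule switch)
        also have "\<dots> \<le> \<mu> * (?E k * V (X 0 w) x0)"
          using \<alpha>\<mu>
          by (intro mult_left_mono
              jls_lyapunov_bound[where V = V and A = A and \<sigma> = "\<lambda>j. X j w", OF decay switch \<alpha>\<mu>])
             (auto simp: d_def b_def)
        finally show ?thesis .
      qed
      have "(\<lambda>k. V s0 (?x k)) \<longlonglongrightarrow> 0"
      proof (rule tendsto_sandwich[OF _ _ tendsto_const])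
        show "(\<lambda>k. \<mu> * (?E k * V (X 0 w) x0)) \<longlonglongrightarrow> 0"
          using E by simp
      qed (simp_all add: V_nonneg bound)
      then have "?x \<longlonglongrightarrow> 0"
        using V by (intro tendsto_0_of_lyapunov[of "V s0"]) (auto simp: lyapunov_candidate_def)
      then show ?case
        using tendsto_infnorm[of ?x 0 sequentially] by (simp add: infnorm_0)
    qed
  qed
qed

section \<open>Feasible points of the linear program\<close>

lemma lp_feasible_row:
  assumes "lp_feasible M \<alpha> \<mu> \<epsilon> \<pi>h p Ph"
  shows "(\<Sum>a\<in>UNIV. \<pi>h $ i $ a) = p $ i"
proof -
  have "(\<pi>h *v 1) $ i = p $ i"
    using assms by (simp add: lp_feasible_def)
  then show ?thesis
    by (simp add: matrix_vector_mult_def)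
qed

lemma lp_feasible_column:
  assumes "lp_feasible M \<alpha> \<mu> \<epsilon> \<pi>h p Ph"
  shows "(\<Sum>i\<in>UNIV. Ph $ i $ j) = p $ j"
proof -
  have "(transpose Ph *v 1) $ j = p $ j"
    using assms by (simp add: lp_feasible_def del: transpose_matrix_vector)
  then show ?thesis
    by (simp add: matrix_vector_mult_def transpose_def del: transpose_matrix_vector)
qed

text \<open>
  The total flow out of the states equals the total flow into them, so no mass of \<open>\<pi>h\<close> can be lost
  at unavailable actions.
\<close>

lemma lp_feasible_unavailable:
  assumes M: "is_mdp M" and lp: "lp_feasible M \<alpha> \<mu> \<epsilon> \<pi>h p Ph"
    and un: "\<not> available M s a"
  shows "\<pi>h $ s $ a = 0"
proof -
  define T where "T i a = (\<Sum>j\<in>UNIV. transition M i a j)" for i a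
  have T: "T i a = (if available M i a then 1 else 0)" for i a
    using M by (auto simp: T_def is_mdp_def available_def)
  note row = lp_feasible_row[OF lp] and col = lp_feasible_column[OF lp]
  have Ph: "Ph $ i $ j = (\<Sum>a\<in>UNIV. transition M i a j * \<pi>h $ i $ a)"
    and nn: "0 \<le> \<pi>h $ i $ a" for i j a
    using lp by (auto simp: lp_feasible_def)
  have row': "(\<Sum>j\<in>UNIV. Ph $ i $ j) = (\<Sum>a\<in>UNIV. T i a * \<pi>h $ i $ a)" for i
    unfolding Ph T_def sum_distrib_right by (rule sum.swap)
  have "(\<Sum>i\<in>UNIV. \<Sum>a\<in>UNIV. (1 - T i a) * \<pi>h $ i $ a) =
      (\<Sum>i\<in>UNIV. p $ i) - (\<Sum>i\<in>UNIV. \<Sum>j\<in>UNIV. Ph $ i $ j)"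
    by (simp add: row' left_diff_distrib sum_subtractf row)
  \<comment> \<open>Swapping the sums turns row sums of \<open>Ph\<close> into column sums, which
    the constraints identify with \<open>p\<close>.\<close>
  also have "\<dots> = 0"
    by (subst sum.swap) (simp add: col)
  finally have "(\<Sum>i\<in>UNIV. \<Sum>a\<in>UNIV. (1 - T i a) * \<pi>h $ i $ a) = 0" .
  moreover have ge: "0 \<le> (1 - T i a) * \<pi>h $ i $ a" for i a
    using nn by (auto simp: T)
  ultimately have "(1 - T s a) * \<pi>h $ s $ a = 0"
    by (simp add: sum_nonneg_eq_0_iff sum_nonneg)
  then show ?thesis
    using un by (simp add: T)
qed

section \<open>From the optimization variables to the policy and its chain\<close>

lemma matrix_inv_diag_matrix_mult:
  fixes p :: "real ^ 's::finite" and B :: "real ^ 'b::finite ^ 's"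
  assumes "\<And>s. p $ s \<noteq> 0"
  shows "(matrix_inv (diag_matrix p) ** B) $ i $ j = B $ i $ j / p $ i"
proof -
  let ?D = "\<chi> i j. if i = j then 1 / p $ i else 0"
  have inverse: "?D ** diag_matrix p = mat 1" "diag_matrix p ** ?D = mat 1"
    using assms
    by (auto simp: matrix_matrix_mult_def diag_matrix_def mat_def vec_eq_iff if_distrib[of "\<lambda>x. x * _"]
             cong: if_cong)
  \<comment> \<open>\<open>matrix_inv\<close> is a choice among two-sided inverses, so uniqueness of
    the inverse identifies it.\<close>
  have "matrix_inv (diag_matrix p) = ?D"
    unfolding matrix_inv_def
  proof (rule some_equality)
    fix D'
    assume "diag_matrix p ** D' = mat 1 \<and> D' ** diag_matrix p = mat 1"
    then have "D' ** (diag_matrix p ** ?D) = ?D"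
      by (simp add: matrix_mul_assoc)
    then show "D' = ?D"
      by (simp only: inverse matrix_mul_rid)
  qed (simp add: inverse)
  then show ?thesis
    by (simp add: matrix_matrix_mult_def if_distrib[of "\<lambda>x. x * _"] cong: if_cong)
qed

lemma stochastic_induced_matrix:
  assumes M: "is_mdp M" and \<pi>: "is_policy M \<pi>"
  shows "stochastic (induced_matrix M \<pi>)"
proof -
  have T_nonneg: "0 \<le> transition M i a j" for i a j
    using M by (cases "available M i a") (auto simp: is_mdp_def available_def)
  have T_sum: "(\<Sum>j\<in>UNIV. transition M i a j) * \<pi> $ i $ a = \<pi> $ i $ a" for i a
    using M \<pi> by (cases "available M i a") (auto simp: is_mdp_def is_policy_def)
  have "(\<Sum>j\<in>UNIV. induced_matrix M \<pi> $ i $ j) = 1" for i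
  proof -
    have "(\<Sum>j\<in>UNIV. induced_matrix M \<pi> $ i $ j) = (\<Sum>a\<in>UNIV. (\<Sum>j\<in>UNIV. transition M i a j) * \<pi> $ i $ a)"
      unfolding induced_matrix_def sum_distrib_right vec_lambda_beta by (rule sum.swap)
    then show ?thesis
      using \<pi> by (simp add: T_sum is_policy_def)
  qed
  then show ?thesis
    using T_nonneg \<pi> by (auto simp: stochastic_def induced_matrix_def is_policy_def intro!: sum_nonneg)
qed

theorem theorem6:
  fixes M :: "('s::finite, 'a::finite) mdp"
    and A :: "'s \<Rightarrow> real ^ 'n::finite ^ 'n"
    and \<alpha> \<mu> \<epsilon> :: real
    and c :: "'s \<Rightarrow> real"
    and \<pi>h \<pi> :: "real ^ 'a ^ 's"
    and p :: "real ^ 's"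
    and Ph P :: "real ^ 's ^ 's"
  assumes "is_mdp M"
    and "mdp_ergodic_unichain M"
    and "stability_constants A \<alpha> \<mu>"
    and "0 < \<epsilon>"
    and "lp_optimal M c \<alpha> \<mu> \<epsilon> \<pi>h p Ph"
  defines "\<pi> \<equiv> matrix_inv (diag_matrix p) ** \<pi>h"
    and "P \<equiv> matrix_inv (diag_matrix p) ** Ph"
  shows "is_policy M \<pi> \<and>
    P = induced_matrix M \<pi> \<and>
    stationary_distribution P p \<and> (\<forall>q. stationary_distribution P q \<longrightarrow> q = p) \<and>
    (\<forall>(W :: 'w measure) X.
       dtmc_process W X (init_state M) P \<longrightarrow> stable_with_probability_one W X A)"
proof -
  have lp: "lp_feasible M \<alpha> \<mu> \<epsilon> \<pi>h p Ph"
    using assms(5) by (simp add: lp_optimal_def)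
  then have "\<epsilon> \<le> p $ s" for s
    by (simp add: lp_feasible_def)
  then have pos: "0 < p $ s" for s
    using \<open>0 < \<epsilon>\<close> by (rule less_le_trans[rotated])
  note row = lp_feasible_row[OF lp] and col = lp_feasible_column[OF lp]
  have Ph: "Ph $ i $ j = (\<Sum>a\<in>UNIV. transition M i a j * \<pi>h $ i $ a)"
    and nn: "0 \<le> \<pi>h $ i $ a" for i j a
    using lp by (auto simp: lp_feasible_def)
  have p_sum: "(\<Sum>s\<in>UNIV. p $ s) = 1"
    using lp by (simp add: lp_feasible_def inner_vec_def)
  have \<pi>: "\<pi> $ i $ a = \<pi>h $ i $ a / p $ i" for i a
    unfolding \<pi>_def using pos by (intro matrix_inv_diag_matrix_mult) (metis less_irrefl)
  have P: "P $ i $ j = Ph $ i $ j / p $ i" for i j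
    unfolding P_def using pos by (intro matrix_inv_diag_matrix_mult) (metis less_irrefl)
  have pP: "p $ i * P $ i $ j = Ph $ i $ j" for i j
    using pos[of i] by (simp add: P)
  \<comment> \<open>After division by \<open>p $ i\<close> this is the upper bound 1 required of a
    policy.\<close>
  have "\<pi>h $ i $ a \<le> p $ i" for i a
    unfolding row[symmetric] by (rule member_le_sum) (auto simp: nn)
  then have policy: "is_policy M \<pi>"
    using pos nn lp_feasible_unavailable[OF \<open>is_mdp M\<close> lp]
    by (auto simp: is_policy_def \<pi> sum_divide_distrib[symmetric] row less_imp_le less_imp_neq[THEN not_sym])
  have induced: "P = induced_matrix M \<pi>"
    by (simp add: vec_eq_iff P induced_matrix_def Ph \<pi> sum_divide_distrib)
  have stoch: "stochastic P"
    unfolding induced by (rule stochastic_induced_matrix[OF \<open>is_mdp M\<close> policy])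
  have inv: "p v* P = p"
    by (simp add: vec_eq_iff vector_matrix_mult_def pP col)
  have "ergodic_unichain P"
    using assms(2) policy by (simp add: mdp_ergodic_unichain_def induced)
  then have irr: "accessible P i j" for i j
    by (rule irreducible_of_positive_invariant[OF _ stoch inv pos p_sum])
  have stationary: "stationary_distribution P p"
    using pos p_sum inv by (simp add: stationary_distribution_def less_imp_le)
  have unique: "q = p" if "stationary_distribution P q" for q
  proof -
    from that have q: "q v* P = q" "(\<Sum>s\<in>UNIV. q $ s) = 1"
      by (auto simp: stationary_distribution_def)
    \<comment> \<open>Invariance fixes \<open>q\<close> up to a scalar and total mass 1 fixes the
      scalar; here \<open>c\<close> is this scalar, not the cost function.\<close>
    obtain c where c: "q = c *\<^sub>R p"
      using invariant_multiple[OF stoch irr inv pos q(1)] by blast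
    have "c = 1"
      using q(2) p_sum by (simp add: c sum_distrib_left[symmetric])
    with c show ?thesis by simp
  qed
  \<comment> \<open>By \<open>pP\<close> the trace of \<open>Ph\<close> is the stationary
    probability of keeping the mode, so the trace constraint is the rate condition.\<close>
  have "1 - (\<Sum>s\<in>UNIV. p $ s * P $ s $ s) < ln (1 / (1 - \<alpha>)) / ln \<mu>"
    using lp unfolding pP lp_feasible_def trace_def by blast
  then have "stable_with_probability_one W X A"
    if "dtmc_process W X (init_state M) P" for W :: "'w measure" and X
    using mjls_stable[OF assms(3) that stoch irr inv pos p_sum] by blast
  with policy induced stationary unique show ?thesis
    by blast
qed

end
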